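(* Let $G$ and $H$ be two connected graphs of order $n_1\ge 2$ and $n_2\ge 2$, respectively. If $D(H)\le 2$, then $pd(G\odot H)\le pd(G)+pd(H)$.
   Context: $D(H)=\max_{u,v}d(u,v)$ is the diameter of $H$, $d$ the shortest-path distance. For a connected graph $F$ and an ordered partition $\Pi=\{P_1,\dots,P_t\}$ of $V(F)$, $r(v|\Pi)=(d(v,P_1),\dots,d(v,P_t))$ where $d(v,P_i)=\min_{u\in P_i}d(v,u)$; $\Pi$ is a resolving partition if $r(u|\Pi)\ne r(v|\Pi)$ for all distinct vertices $u,v$; $pd(F)$ is the minimum number of sets in a resolving partition. For graphs $G$ of order $n_1$ (vertices $v_1,\dots,v_{n_1}$) and $H$, the corona product $G\odot H$ is obtained from one copy of $G$ and $n_1$ copies $H_1,\dots,H_{n_1}$ of $H$ by joining $v_i$ to every vertex of $H_i$. *)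

theory Defs
  imports "Graph_Theory.Graph_Theory" "HOL-Library.Disjoint_Sets"
begin

text \<open>
  Finite simple graphs are values of type \<^typ>\<open>'a pair_pre_digraph\<close> satisfying
  \<^locale>\<open>pair_graph\<close>: each undirected edge is represented by its two arcs.
  Distances are infinite between vertices not joined by a walk.
\<close>

definition gdist :: "'a pair_pre_digraph \<Rightarrow> 'a \<Rightarrow> 'a \<Rightarrow> ereal" where
  "gdist F u v = wf_digraph.\<mu> (with_proj F) (\<lambda>_. 1) u v"

definition gdist_set :: "'a pair_pre_digraph \<Rightarrow> 'a \<Rightarrow> 'a set \<Rightarrow> ereal" where
  "gdist_set F v P = Min (gdist F v ` P)"

definition gdiameter :: "'a pair_pre_digraph \<Rightarrow> ereal" where
  "gdiameter F = Max {gdist F u v | u v. u \<in> pverts F \<and> v \<in> pverts F}"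

definition representation :: "'a pair_pre_digraph \<Rightarrow> 'a set list \<Rightarrow> 'a \<Rightarrow> ereal list" where
  "representation F Ps v = map (gdist_set F v) Ps"

definition ordered_partition :: "'a set \<Rightarrow> 'a set list \<Rightarrow> bool" where
  "ordered_partition V Ps \<longleftrightarrow> distinct Ps \<and> partition_on V (set Ps)"

definition resolving_partition :: "'a pair_pre_digraph \<Rightarrow> 'a set list \<Rightarrow> bool" where
  "resolving_partition F Ps \<longleftrightarrow>
     ordered_partition (pverts F) Ps \<and>
     (\<forall>u\<in>pverts F. \<forall>v\<in>pverts F. u \<noteq> v \<longrightarrow> representation F Ps u \<noteq> representation F Ps v)"

definition pd :: "'a pair_pre_digraph \<Rightarrow> nat" where
  "pd F = (LEAST t. \<exists>Ps. resolving_partition F Ps \<and> length Ps = t)"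

text \<open>
  In the corona product, \<open>Inl v\<close> is the vertex \<open>v\<close> of \<open>G\<close>, and \<open>Inr (v, x)\<close> is the
  vertex \<open>x\<close> in the copy of \<open>H\<close> attached to \<open>v\<close>.
\<close>

definition corona :: "'a pair_pre_digraph \<Rightarrow> 'b pair_pre_digraph \<Rightarrow> ('a + 'a \<times> 'b) pair_pre_digraph"
  where
  "corona G H = \<lparr>
     pverts = pverts G <+> (pverts G \<times> pverts H),
     parcs =
       {(Inl u, Inl v) | u v. (u, v) \<in> parcs G} \<union>
       {(Inr (v, x), Inr (v, y)) | v x y. v \<in> pverts G \<and> (x, y) \<in> parcs H} \<union>
       {(Inl v, Inr (v, x)) | v x. v \<in> pverts G \<and> x \<in> pverts H} \<union>
       {(Inr (v, x), Inl v) | v x. v \<in> pverts G \<and> x \<in> pverts H} \<rparr>"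

lemma pair_graph_corona:
  assumes "pair_graph G" and "pair_graph H"
  shows "pair_graph (corona G H)"
proof -
  interpret G: pair_graph G by fact
  interpret H: pair_graph H by fact
  let ?C = "corona G H"
  have sub: "parcs ?C \<subseteq> pverts ?C \<times> pverts ?C"
    unfolding corona_def
    by (auto dest: G.in_arcsD1 G.in_arcsD2 H.in_arcsD1 H.in_arcsD2)
  have fin: "finite (pverts ?C)"
    unfolding corona_def by auto
  have finA: "finite (parcs ?C)"
    using sub fin by (meson finite_SigmaI finite_subset)
  have nl: "fst e \<noteq> snd e" if "e \<in> parcs ?C" for e
    using that unfolding corona_def by (auto dest: G.pair_no_loops H.pair_no_loops)
  have "sym (parcs G)" "sym (parcs H)"
    using G.pair_sym_arcs H.pair_sym_arcs by (simp_all add: symmetric_def)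
  then have "sym (parcs ?C)"
    unfolding corona_def sym_def by auto
  then have sy: "symmetric (with_proj ?C)" by (simp add: symmetric_def)
  show ?thesis
    using sub fin finA nl sy by unfold_locales auto
qed

lemma gdist_self:
  assumes "pair_graph F" and "u \<in> pverts F"
  shows "gdist F u u = 0"
proof -
  interpret pair_graph F by fact
  have "0 \<le> gdist F u u"
    unfolding gdist_def \<mu>_def by (auto intro!: INF_greatest simp: pos_cost_pos_awalk_cost)
  moreover have "gdist F u u \<le> 0"
    using min_cost_le_walk_cost[of u "[]" u "\<lambda>_. 1"] assms(2)
    by (simp add: gdist_def awalk_Nil_iff zero_ereal_def)
  ultimately show ?thesis by (rule antisym[rotated])
qed

lemma gdist_ge_1:
  assumes "pair_graph F" and "u \<noteq> v"
  shows "1 \<le> gdist F u v"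
proof -
  interpret pair_graph F by fact
  have "1 \<le> awalk_cost (\<lambda>_. 1) p" if "awalk u p v" for p
    using that assms(2) by (cases p) (auto simp: awalk_Nil_iff awalk_cost_def sum_list_triv)
  then show ?thesis
    unfolding gdist_def \<mu>_def by (auto intro!: INF_greatest simp: one_ereal_def)
qed

text \<open>The partition into singletons is resolving, so the minimum in \<^const>\<open>pd\<close> is attained.\<close>

lemma pd_attained:
  assumes "pair_graph F"
  shows "\<exists>Ps. resolving_partition F Ps \<and> length Ps = pd F"
proof -
  interpret pair_graph F by fact
  obtain vs where vs: "set vs = pverts F" "distinct vs"
    using finite_distinct_list[OF pair_finite_verts] by auto
  let ?Ps = "map (\<lambda>v. {v}) vs"
  have "ordered_partition (pverts F) ?Ps"
    using vs by (auto simp: ordered_partition_def distinct_map inj_on_def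
        partition_on_def disjoint_def)
  moreover have "representation F ?Ps u \<noteq> representation F ?Ps v"
    if "u \<in> pverts F" "v \<in> pverts F" "u \<noteq> v" for u v
  proof
    assume "representation F ?Ps u = representation F ?Ps v"
    then have "gdist F u u = gdist F v u"
      using vs that by (auto simp: representation_def gdist_set_def)
    then show False
      using gdist_self[OF assms that(1)] gdist_ge_1[OF assms that(3)[symmetric]] by simp
  qed
  ultimately have "resolving_partition F ?Ps"
    unfolding resolving_partition_def by blast
  then have "\<exists>t Ps. resolving_partition F Ps \<and> length Ps = t" by blast
  then show ?thesis unfolding pd_def by (rule LeastI_ex)
qed

end

theory Submission
  imports Defs
begin

text \<open>
  Attach the classes of a resolving partition of \<open>G\<close> to those of \<open>H\<close>, each class \<open>B\<close> of \<open>H\<close> being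
  spread over all copies as \<open>V(G) \<times> B\<close>. Distances to the classes from \<open>G\<close> determine the vertex
  of \<open>G\<close>, or the copy of \<open>H\<close>. Since \<open>D(H) \<le> 2\<close>, the detour through \<open>G\<close> shortens no distance
  inside a copy, so the classes from \<open>H\<close> separate the vertices of each copy.
  Distances are compared through the fact that \<open>d(\<cdot>, P)\<close> is the greatest function that is at
  most \<open>0\<close> on \<open>P\<close> and changes by at most \<open>1\<close> along arcs.
\<close>

section \<open>Distance to a single vertex\<close>

lemma gdist_arc_step:
  assumes "pair_graph F" and "(u, v) \<in> parcs F"
  shows "gdist F u w \<le> 1 + gdist F v w"
proof -
  interpret pair_graph F by fact
  \<comment> \<open>With the 1 moved to the left, the claim bounds every walk cost from below, hence
    also the infimum that defines \<open>gdist F v w\<close>.\<close>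
  have "gdist F u w - 1 \<le> ereal (awalk_cost (\<lambda>_. 1) p)" if "awalk v p w" for p
  proof -
    have "awalk u ((u, v) # p) w"
      using that assms(2) by (simp add: awalk_Cons_iff)
    from min_cost_le_walk_cost[OF this, of "\<lambda>_. 1"]
    have "gdist F u w \<le> ereal (1 + awalk_cost (\<lambda>_. 1) p)"
      by (simp add: gdist_def)
    then show ?thesis
      by (cases "gdist F u w") (auto simp: one_ereal_def)
  qed
  then have "gdist F u w - 1 \<le> gdist F v w"
    unfolding gdist_def[of F v w] \<mu>_def by (auto intro!: INF_greatest)
  then show ?thesis
    by (simp add: ereal_minus_le add.commute)
qed

text \<open>Induction along a walk to \<open>w\<close>: each arc costs 1 and accounts for a change
  of at most 1 in \<open>f\<close>. Without a walk the distance is infinite. This yields lower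
  bounds on distances without inspecting shortest walks.\<close>

lemma gdist_greatest:
  fixes f :: "'a \<Rightarrow> ereal"
  assumes "pair_graph F" and "f w \<le> 0"
    and step: "\<And>u v. (u, v) \<in> parcs F \<Longrightarrow> f u \<le> 1 + f v"
  shows "f u \<le> gdist F u w"
proof -
  interpret pair_graph F by fact
  have "f u \<le> ereal (awalk_cost (\<lambda>_. 1) p)" if "awalk u p w" for p
    using that
  proof (induction p arbitrary: u)
    case Nil
    then show ?case using assms(2) by (simp add: awalk_Nil_iff zero_ereal_def)
  next
    case (Cons e p)
    then have "(u, snd e) \<in> parcs F" "awalk (snd e) p w"
      by (auto simp: awalk_Cons_iff)
    then have "f u \<le> 1 + f (snd e)" "f (snd e) \<le> ereal (awalk_cost (\<lambda>_. 1) p)"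
      using step Cons.IH by auto
    then have "f u \<le> 1 + ereal (awalk_cost (\<lambda>_. 1) p)"
      by (meson add_left_mono order_trans)
    then show ?case by (simp add: one_ereal_def)
  qed
  then show ?thesis
    unfolding gdist_def \<mu>_def by (auto intro!: INF_greatest)
qed

lemma gdist_nonneg:
  assumes "pair_graph F"
  shows "0 \<le> gdist F u v"
  using gdist_greatest[OF assms, of "\<lambda>_. 0"] by simp

lemma gdist_le_gdiameter:
  assumes "pair_graph F" and "u \<in> pverts F" and "v \<in> pverts F"
  shows "gdist F u v \<le> gdiameter F"
proof -
  interpret pair_graph F by fact
  \<comment> \<open>As an image of a finite product the set is finite, so \<open>Max\<close> bounds
    its members.\<close>
  have "{gdist F u v | u v. u \<in> pverts F \<and> v \<in> pverts F} =
      (\<lambda>(u, v). gdist F u v) ` (pverts F \<times> pverts F)"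
    by auto
  then have "finite {gdist F u v | u v. u \<in> pverts F \<and> v \<in> pverts F}"
    by simp
  then show ?thesis
    unfolding gdiameter_def using assms by (intro Max_ge) auto
qed

section \<open>Distance to a vertex set\<close>

locale pair_graph_vertex_set = pair_graph F for F :: "'a pair_pre_digraph" +
  fixes P
  assumes subset: "P \<subseteq> pverts F" and nonempty: "P \<noteq> {}"
begin

text \<open>Together with \<open>nonempty\<close>, this makes \<open>Min\<close> in
  \<open>gdist_set\<close> a genuine minimum, attained at some member of \<open>P\<close>.\<close>

lemma finite_distances: "finite (gdist F v ` P)"
  using subset by (meson finite_imageI finite_subset pair_finite_verts)

lemma gdist_set_le: "p \<in> P \<Longrightarrow> gdist_set F v P \<le> gdist F v p"
  unfolding gdist_set_def using finite_distances by simp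

lemma gdist_set_ge_iff: "c \<le> gdist_set F v P \<longleftrightarrow> (\<forall>p\<in>P. c \<le> gdist F v p)"
  unfolding gdist_set_def using finite_distances nonempty by simp

lemma gdist_set_nonneg: "0 \<le> gdist_set F v P"
  by (simp add: gdist_set_ge_iff gdist_nonneg pair_graph_axioms)

lemma gdist_set_member: "v \<in> P \<Longrightarrow> gdist_set F v P \<le> 0"
  using gdist_set_le[of v v] gdist_self[OF pair_graph_axioms] subset by (metis subsetD)

lemma gdist_set_nonmember: "v \<notin> P \<Longrightarrow> 1 \<le> gdist_set F v P"
  unfolding gdist_set_ge_iff using gdist_ge_1[OF pair_graph_axioms] by metis

lemma gdist_set_arc_step:
  assumes "(u, v) \<in> parcs F"
  shows "gdist_set F u P \<le> 1 + gdist_set F v P"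
proof -
  \<comment> \<open>A member of \<open>P\<close> nearest to \<open>v\<close> also serves as a target
    from \<open>u\<close>, one arc further away.\<close>
  have "gdist_set F v P \<in> gdist F v ` P"
    unfolding gdist_set_def using finite_distances nonempty by (intro Min_in) auto
  then obtain p where "p \<in> P" "gdist_set F v P = gdist F v p" by auto
  then show ?thesis
    using gdist_set_le[of p u] gdist_arc_step[OF pair_graph_axioms assms, of p] by simp
qed

lemma gdist_set_greatest:
  fixes f :: "'a \<Rightarrow> ereal"
  assumes "\<And>p. p \<in> P \<Longrightarrow> f p \<le> 0"
    and "\<And>u v. (u, v) \<in> parcs F \<Longrightarrow> f u \<le> 1 + f v"
  shows "f u \<le> gdist_set F u P"
  unfolding gdist_set_ge_iff
  using gdist_greatest[where f = f, OF pair_graph_axioms] assms by blast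

end

lemma gdist_set_le_gdiameter:
  assumes "pair_graph F" and "P \<subseteq> pverts F" and "P \<noteq> {}" and "u \<in> pverts F"
  shows "gdist_set F u P \<le> gdiameter F"
proof -
  interpret pair_graph_vertex_set F P
    using assms by (simp add: pair_graph_vertex_set_def pair_graph_vertex_set_axioms_def)
  obtain p where "p \<in> P" using nonempty by blast
  then show ?thesis
    using gdist_set_le[of p u] gdist_le_gdiameter[OF assms(1,4), of p] subset
    by (meson order_trans subsetD)
qed

section \<open>Distances to classes in the corona\<close>

lemma pverts_corona: "pverts (corona G H) = Inl ` pverts G \<union> Inr ` (pverts G \<times> pverts H)"
  by (auto simp: corona_def)

lemma corona_arcs:
  "(u, v) \<in> parcs G \<Longrightarrow> (Inl u, Inl v) \<in> parcs (corona G H)"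
  "v \<in> pverts G \<Longrightarrow> (x, y) \<in> parcs H \<Longrightarrow> (Inr (v, x), Inr (v, y)) \<in> parcs (corona G H)"
  "v \<in> pverts G \<Longrightarrow> x \<in> pverts H \<Longrightarrow> (Inr (v, x), Inl v) \<in> parcs (corona G H)"
  by (auto simp: corona_def)

lemma corona_arc_cases:
  assumes "(a, b) \<in> parcs (corona G H)"
  obtains u v where "a = Inl u" "b = Inl v" "(u, v) \<in> parcs G"
  | v x y where "a = Inr (v, x)" "b = Inr (v, y)" "v \<in> pverts G" "(x, y) \<in> parcs H"
  | v x where "a = Inl v" "b = Inr (v, x)" "v \<in> pverts G" "x \<in> pverts H"
  | v x where "a = Inr (v, x)" "b = Inl v" "v \<in> pverts G" "x \<in> pverts H"
  using assms by (auto simp: corona_def)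

text \<open>A copy of \<open>H\<close> meets the rest of the corona only at its root, so excursions
  into copies shorten no walk in \<open>G\<close>, and a vertex of a copy is exactly one step
  further from \<open>A\<close> than its root.\<close>

lemma gdist_set_corona_Inl:
  assumes G: "pair_graph G" and H: "pair_graph H"
    and A: "A \<subseteq> pverts G" "A \<noteq> {}"
  shows "gdist_set (corona G H) (Inl v) (Inl ` A) = gdist_set G v A" (is ?base)
    and "v \<in> pverts G \<Longrightarrow> x \<in> pverts H \<Longrightarrow>
      gdist_set (corona G H) (Inr (v, x)) (Inl ` A) = 1 + gdist_set G v A" (is "_ \<Longrightarrow> _ \<Longrightarrow> ?copy")
proof -
  interpret G: pair_graph_vertex_set G A
    using assms by (simp add: pair_graph_vertex_set_def pair_graph_vertex_set_axioms_def)
  interpret C: pair_graph_vertex_set "corona G H" "Inl ` A"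
    using assms pair_graph_corona[OF G H]
    by (auto simp: pair_graph_vertex_set_def pair_graph_vertex_set_axioms_def pverts_corona)
  \<comment> \<open>The expected distance. It is constant on each copy and larger by 1 than at the
    root.\<close>
  let ?f = "case_sum (\<lambda>v. gdist_set G v A) (\<lambda>(v, x). 1 + gdist_set G v A)"
  have plus: "c \<le> 1 + c" for c :: ereal
    by (cases c) (auto simp: one_ereal_def)
  have lower: "?f a \<le> gdist_set (corona G H) a (Inl ` A)" for a
  proof (rule C.gdist_set_greatest)
    show "?f p \<le> 0" if "p \<in> Inl ` A" for p
      using that by (auto simp: G.gdist_set_member)
    show "?f a \<le> 1 + ?f b" if "(a, b) \<in> parcs (corona G H)" for a b
      using that
      by (cases rule: corona_arc_cases)
        (auto simp: plus G.gdist_set_arc_step intro: order_trans[OF plus plus])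
  qed
  \<comment> \<open>The corona distance, restricted to \<open>G\<close>, is itself a competitor for
    the greatest function on \<open>G\<close>.\<close>
  have upper: "gdist_set (corona G H) (Inl v) (Inl ` A) \<le> gdist_set G v A" for v
    by (rule G.gdist_set_greatest)
      (auto intro!: C.gdist_set_member C.gdist_set_arc_step corona_arcs)
  show ?base
    using lower[of "Inl v"] upper by (simp add: antisym)
  show ?copy if "v \<in> pverts G" "x \<in> pverts H"
  proof (rule antisym)
    have "gdist_set (corona G H) (Inr (v, x)) (Inl ` A) \<le>
        1 + gdist_set (corona G H) (Inl v) (Inl ` A)"
      using that by (intro C.gdist_set_arc_step corona_arcs)
    then show "gdist_set (corona G H) (Inr (v, x)) (Inl ` A) \<le> 1 + gdist_set G v A"
      using \<open>?base\<close> by simp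
  qed (use lower[of "Inr (v, x)"] in simp)
qed

text \<open>Leaving a copy and entering any copy again costs at least 2, which is no less than a
  distance within \<open>H\<close>. So a nearest point of the spread class can be found in the same
  copy.\<close>

lemma gdist_set_corona_Inr:
  assumes G: "pair_graph G" and H: "pair_graph H" and "gdiameter H \<le> 2"
    and B: "B \<subseteq> pverts H" "B \<noteq> {}" and v: "v \<in> pverts G"
  shows "gdist_set (corona G H) (Inr (v, x)) (Inr ` (pverts G \<times> B)) = gdist_set H x B"
proof -
  interpret H: pair_graph_vertex_set H B
    using assms by (simp add: pair_graph_vertex_set_def pair_graph_vertex_set_axioms_def)
  interpret C: pair_graph_vertex_set "corona G H" "Inr ` (pverts G \<times> B)"
    using assms pair_graph_corona[OF G H]
    by (auto simp: pair_graph_vertex_set_def pair_graph_vertex_set_axioms_def pverts_corona)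
  \<comment> \<open>The value 1 on \<open>G\<close> is the distance from a root to the class: each
    root is adjacent to the nonempty set \<open>B\<close> in its own copy.\<close>
  let ?f = "case_sum (\<lambda>_. 1) (\<lambda>(v, x). gdist_set H x B) :: _ \<Rightarrow> ereal"
  \<comment> \<open>The diameter bound enters here: on an arc from a copy to its root,
    \<open>?f\<close> may drop by at most 1, to the value 1.\<close>
  have two: "gdist_set H x B \<le> 1 + 1" if "x \<in> pverts H" for x
    using gdist_set_le_gdiameter[OF H B that] assms(3) by simp
  have "?f a \<le> gdist_set (corona G H) a (Inr ` (pverts G \<times> B))" for a
  proof (rule C.gdist_set_greatest)
    show "?f p \<le> 0" if "p \<in> Inr ` (pverts G \<times> B)" for p
      using that by (auto simp: H.gdist_set_member)
    show "?f a \<le> 1 + ?f b" if "(a, b) \<in> parcs (corona G H)" for a b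
      using that
    proof (cases rule: corona_arc_cases)
      case (3 v x)
      then show ?thesis
        using add_left_mono[OF H.gdist_set_nonneg[of x], of 1] by simp
    next
      case (4 v x)
      then show ?thesis using two by simp
    qed (auto simp: H.gdist_set_arc_step)
  qed
  from this[of "Inr (v, x)"]
  have "gdist_set H x B \<le> gdist_set (corona G H) (Inr (v, x)) (Inr ` (pverts G \<times> B))"
    by simp
  \<comment> \<open>The corona distance, restricted to the copy at \<open>v\<close>, competes for
    the greatest function on \<open>H\<close>.\<close>
  moreover have "gdist_set (corona G H) (Inr (v, x)) (Inr ` (pverts G \<times> B)) \<le> gdist_set H x B"
    using v by (intro H.gdist_set_greatest)
      (auto intro!: C.gdist_set_member C.gdist_set_arc_step corona_arcs)
  ultimately show ?thesis by (rule antisym[rotated])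
qed

section \<open>The combined partition and its resolving property\<close>

lemma ordered_partition_corona:
  fixes G :: "'a pair_pre_digraph" and H :: "'b pair_pre_digraph"
  assumes "ordered_partition (pverts G) Ps" and "ordered_partition (pverts H) Qs"
    and "pverts G \<noteq> {}"
  shows "ordered_partition (pverts (corona G H))
    (map ((`) Inl) Ps @ map (\<lambda>Q. Inr ` (pverts G \<times> Q)) Qs)"
proof -
  have P: "distinct Ps" "\<Union> (set Ps) = pverts G" "disjoint (set Ps)" "{} \<notin> set Ps"
    and Q: "distinct Qs" "\<Union> (set Qs) = pverts H" "disjoint (set Qs)" "{} \<notin> set Qs"
    using assms by (auto simp: ordered_partition_def partition_on_def)
  \<comment> \<open>A product with the nonempty set \<open>pverts G\<close> determines its second
    factor, so distinct classes of \<open>H\<close> stay distinct when spread.\<close>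
  have inj: "inj_on ((`) Inl) (set Ps)"
    "inj_on (\<lambda>Q. Inr ` (pverts G \<times> Q)) (set Qs)"
    using assms(3) by (auto simp: inj_on_def inj_image_eq_iff times_eq_iff)
  \<comment> \<open>Classes from \<open>G\<close> and from \<open>H\<close> could coincide only if
    both were empty, which a partition excludes.\<close>
  have Inl_image: "Inl ` X = Inr ` Y \<longleftrightarrow> X = {} \<and> Y = {}"
    for X :: "'a set" and Y :: "('a \<times> 'b) set"
    by auto
  have "distinct (map ((`) Inl) Ps @ map (\<lambda>Q. Inr ` (pverts G \<times> Q)) Qs)"
    using P Q inj by (auto simp: distinct_map Inl_image)
  moreover have "partition_on (pverts (corona G H))
      (set (map ((`) Inl) Ps @ map (\<lambda>Q. Inr ` (pverts G \<times> Q)) Qs))"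
  proof (rule partition_onI)
    have "\<Union> (set (map ((`) Inl) Ps @ map (\<lambda>Q. Inr ` (pverts G \<times> Q)) Qs)) =
        Inl ` \<Union> (set Ps) \<union> Inr ` (pverts G \<times> \<Union> (set Qs))"
      by auto
    then show "\<Union> (set (map ((`) Inl) Ps @ map (\<lambda>Q. Inr ` (pverts G \<times> Q)) Qs)) =
        pverts (corona G H)"
      by (simp only: pverts_corona P(2) Q(2))
  next
    fix X Y
    assume "X \<in> set (map ((`) Inl) Ps @ map (\<lambda>Q. Inr ` (pverts G \<times> Q)) Qs)"
      "Y \<in> set (map ((`) Inl) Ps @ map (\<lambda>Q. Inr ` (pverts G \<times> Q)) Qs)" and ne: "X \<noteq> Y"
    then consider P P' where "X = Inl ` P" "Y = Inl ` P'" "P \<in> set Ps" "P' \<in> set Ps"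
      | Q Q' where "X = Inr ` (pverts G \<times> Q)" "Y = Inr ` (pverts G \<times> Q')" "Q \<in> set Qs" "Q' \<in> set Qs"
      | P Q where "X = Inl ` P" "Y = Inr ` (pverts G \<times> Q)"
      | P Q where "X = Inr ` (pverts G \<times> Q)" "Y = Inl ` P"
      unfolding set_append set_map by (elim UnE imageE)
    then show "disjnt X Y"
    proof cases
      case 1
      then have "P \<inter> P' = {}" using P(3) ne by (auto dest: disjointD)
      then show ?thesis using 1 by (auto simp: disjnt_def)
    next
      case 2
      then have "Q \<inter> Q' = {}" using Q(3) ne by (auto dest: disjointD)
      then show ?thesis using 2 by (auto simp: disjnt_def)
    qed (auto simp: disjnt_def)
  qed (use P(4) Q(4) assms(3) in auto)
  ultimately show ?thesis
    unfolding ordered_partition_def by blast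
qed

lemma resolving_partition_corona:
  assumes G: "pair_graph G" and H: "pair_graph H" and diam: "gdiameter H \<le> 2"
    and Ps: "resolving_partition G Ps" and Qs: "resolving_partition H Qs"
    and ne: "pverts G \<noteq> {}"
  shows "resolving_partition (corona G H)
    (map ((`) Inl) Ps @ map (\<lambda>Q. Inr ` (pverts G \<times> Q)) Qs)" (is "resolving_partition ?C ?Rs")
proof -
  have part: "ordered_partition (pverts G) Ps" "ordered_partition (pverts H) Qs"
    using Ps Qs by (auto simp: resolving_partition_def)
  have P: "P \<subseteq> pverts G" "P \<noteq> {}" if "P \<in> set Ps" for P
    using that part by (auto simp: ordered_partition_def partition_on_def)
  have Q: "Q \<subseteq> pverts H" "Q \<noteq> {}" if "Q \<in> set Qs" for Q
    using that part by (auto simp: ordered_partition_def partition_on_def)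
  note dist = gdist_set_corona_Inl[OF G H P] gdist_set_corona_Inr[OF G H diam Q]
  \<comment> \<open>The class of \<open>u\<close> itself separates the two: its distance is 0 from
    \<open>u\<close> and at least 1 from every vertex of a copy.\<close>
  have mixed: "representation ?C ?Rs (Inl u) \<noteq> representation ?C ?Rs (Inr b)"
    if "u \<in> pverts G" for u b
  proof -
    have "u \<in> \<Union> (set Ps)"
      using that part(1) by (simp add: ordered_partition_def partition_on_def)
    then obtain A where A: "A \<in> set Ps" "u \<in> A" by blast
    interpret pair_graph_vertex_set ?C "Inl ` A"
      using P[OF A(1)] pair_graph_corona[OF G H]
      by (auto simp: pair_graph_vertex_set_def pair_graph_vertex_set_axioms_def pverts_corona)
    have "gdist_set ?C (Inl u) (Inl ` A) \<le> 0"
      using A(2) by (intro gdist_set_member) simp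
    also have "0 < (1 :: ereal)" by simp
    also have "1 \<le> gdist_set ?C (Inr b) (Inl ` A)"
      by (rule gdist_set_nonmember) auto
    finally have "gdist_set ?C (Inl u) (Inl ` A) \<noteq> gdist_set ?C (Inr b) (Inl ` A)"
      by simp
    then show ?thesis using A(1) by (auto simp: representation_def)
  qed
  have base: "u = v" if "representation G Ps u = representation G Ps v"
    "u \<in> pverts G" "v \<in> pverts G" for u v
    using Ps that by (auto simp: resolving_partition_def)
  have "a = b" if ab: "a \<in> pverts ?C" "b \<in> pverts ?C"
    and eq: "representation ?C ?Rs a = representation ?C ?Rs b" for a b
  proof -
    consider u v where "a = Inl u" "b = Inl v" "u \<in> pverts G" "v \<in> pverts G"
      | u x v y where "a = Inr (u, x)" "b = Inr (v, y)" "u \<in> pverts G" "v \<in> pverts G"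
          "x \<in> pverts H" "y \<in> pverts H"
      using ab eq mixed mixed[symmetric] unfolding pverts_corona by blast
    then show ?thesis
    proof cases
      case 1
      then have "representation G Ps u = representation G Ps v"
        using eq by (simp add: representation_def dist)
      then show ?thesis using 1 base by simp
    next
      case 2
      \<comment> \<open>For vertices of copies the coordinates from \<open>Ps\<close> are those of
        the roots plus 1; the finite summand cancels in \<open>ereal\<close>.\<close>
      then have "representation G Ps u = representation G Ps v"
        using eq by (simp add: representation_def dist ereal_add_cancel_left)
      then have "u = v" using 2 base by blast
      \<comment> \<open>The coordinates from \<open>Qs\<close> are the same in every copy, so they
        are exactly the coordinates of \<open>x\<close> and \<open>y\<close> in
        \<open>H\<close>.\<close>
      moreover have "representation H Qs x = representation H Qs y"
        using eq 2 by (simp add: representation_def dist)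
      then have "x = y" using Qs 2 by (auto simp: resolving_partition_def)
      ultimately show ?thesis using 2 by simp
    qed
  qed
  then show ?thesis
    unfolding resolving_partition_def using ordered_partition_corona[OF part ne] by blast
qed

theorem theorem5:
  fixes G :: "'a pair_pre_digraph" and H :: "'b pair_pre_digraph"
  assumes "pair_graph G" and "connected (with_proj G)" and "card (pverts G) \<ge> 2"
    and "pair_graph H" and "connected (with_proj H)" and "card (pverts H) \<ge> 2"
    and "gdiameter H \<le> 2"
  shows "pd (corona G H) \<le> pd G + pd H"
proof -
  \<comment> \<open>Minimum resolving partitions of \<open>G\<close> and \<open>H\<close> are
    combined class by class, so the length of the resulting list is the sum of the two dimensions
    and bounds the minimum for the corona.\<close>
  obtain Ps where Ps: "resolving_partition G Ps" "length Ps = pd G"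
    using pd_attained[OF assms(1)] by blast
  obtain Qs where Qs: "resolving_partition H Qs" "length Qs = pd H"
    using pd_attained[OF assms(4)] by blast
  have "pverts G \<noteq> {}" using assms(3) by auto
  then have "resolving_partition (corona G H)
      (map ((`) Inl) Ps @ map (\<lambda>Q. Inr ` (pverts G \<times> Q)) Qs)" (is "resolving_partition _ ?Rs")
    by (intro resolving_partition_corona assms Ps(1) Qs(1))
  moreover have "length ?Rs = pd G + pd H"
    using Ps(2) Qs(2) by simp
  ultimately show ?thesis
    unfolding pd_def[of "corona G H"] by (intro Least_le exI[of _ ?Rs] conjI)
qed

end
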